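(* Let $k\ge 1$, let $\Lambda$ be a connected $k$-graph, let $v\in\Lambda^0$, and let $T$ be a maximal spanning tree for the $1$-skeleton $\mathrm{Sk}_\Lambda$. Then there is an isomorphism of groups $$\pi_1(\Lambda,v)\;\cong\;\big\langle\, \mathrm{Sk}_\Lambda^1 \;\big|\; t=1 \text{ if } t\in T^1,\ \ ef=gh \text{ if } (ef,gh)\in S^+ \,\big\rangle ,$$ where the right-hand side is the group with generating set $\mathrm{Sk}_\Lambda^1$ and the indicated relations, $(ef,gh)$ ranges over the pairs of length-two paths in $S^+$, and a formal inverse edge occurring in such a pair is read as the inverse of the corresponding generator.
   Context: **$k$-graphs.** $\mathbb{N}^k$ is the additive monoid of $k$-tuples of natural numbers (including $0$) with canonical generators $e_1,\dots,e_k$. A $k$-graph is a countable category $\Lambda$ with a functor $d:\Lambda\to\mathbb{N}^k$ satisfying the factorisation property: if $\lambda\in\Lambda$ and $d(\lambda)=m+n$ with $m,n\in\mathbb{N}^k$, then there are unique $\mu,\nu\in\Lambda$ with $d(\mu)=m$, $d(\nu)=n$ and $\lambda=\mu\nu$. Write $r$ and $s$ for codomain and domain; $\mu\nu$ is defined when $s(\mu)=r(\nu)$. Put $\Lambda^m=d^{-1}(m)$; $\Lambda^0$ is identified with the set of objects (vertices). $\Lambda$ is connected if the equivalence relation on $\Lambda^0$ generated by "$u\sim w$ iff there is $\lambda\in\Lambda$ with $r(\lambda)=u$, $s(\lambda)=w$" is all of $\Lambda^0\times\Lambda^0$. **$1$-skeleton.** $E=\mathrm{Sk}_\Lambda$ is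 the directed graph with vertex set $E^0=\Lambda^0$, edge set $E^1=\bigcup_{i\le k}\Lambda^{e_i}$, and range and source maps $r,s$ inherited from $\Lambda$. (Edges in $\Lambda^{e_i}$ have colour $c_i$.) **Paths.** In a directed graph $E=(E^0,E^1,r,s)$ a path of length $n$ is a sequence $\mu_1\cdots\mu_n$ of edges with $s(\mu_i)=r(\mu_{i+1})$; its range is $r(\mu_1)$ and its source is $s(\mu_n)$; vertices are paths of length $0$. $\mathcal{P}(E)$ is the category of all finite paths. For each $e\in E^1$ introduce a formal inverse edge $e^{-1}$ with $s(e^{-1})=r(e)$, $r(e^{-1})=s(e)$; set $E^{-1}=\{e^{-1}:e\in E^1\}$, $E^u=E^1\cup E^{-1}$, $(e^{-1})^{-1}=e$, and let $E^+$ be the directed graph $(E^0,E^u,r,s)$. Elements of $\mathcal{P}(E^+)$ are undirected paths in $E$; such a path is reduced if it contains no subword $ee^{-1}$ with $e\in E^u$ (vertices are reduced). **Trees.** $E$ is connected if any two vertices are joined by an undirected path. A tree is a connected directed graph in which the only reduced undirected paths with equal source and range are vertices. A maximal spanning tree of $E$ is a subgraph $T$ that is a tree with $T^0=E^0$. **Relations.** $C=\{(e^{-1}e,s(e)):e\in E^u\}$ is the set of cancellation relations on $\mathcal{P}(E^+)$. For $E=\mathrm{Sk}_\Lambda$, the commuting squares of $\Lambda$ are the pairs $(fg,g'f')$ of length-two paths in $E$ where, for some $i\neq j$, $f,f'\in\Lambda^{e_i}$, $g,g'\in\Lambda^{e_j}$, and $fg=g'f'$ in $\Lambda$. $S$ is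 the equivalence relation on $\mathcal{P}(E)$ generated by replacing, in a path, two consecutive edges forming one side of a commuting square by the other side. $S^+$ is the relation on $\mathcal{P}(E^+)$ obtained from $S$ by adding $(f^{-1}e^{-1},h^{-1}g^{-1})$ whenever $(ef,gh)\in S$ (with $e,f,g,h\in E^1$). **Fundamental groupoid and group.** $\mathcal{G}(\Lambda)=\mathcal{P}(\mathrm{Sk}_\Lambda^+)/(C\cup S^+)$ is the quotient category by the smallest congruence (equivalence relation on morphisms, preserving range and source, compatible with composition) containing $C\cup S^+$; it is a groupoid with object set $\Lambda^0$. The fundamental group $\pi_1(\Lambda,v)=v\,\mathcal{G}(\Lambda)\,v$ is its isotropy group at $v$, i.e. the group of elements with range and source $v$. *)

theory Defs
  imports
    "HOL-Algebra.Group"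
    "HOL-Analysis.Finite_Cartesian_Product"
    "HOL-Library.Countable_Set"
    "Graph_Theory.Digraph_Component"
begin

section \<open>Categories and quotient categories\<close>

record ('v, 'm) pre_category =
  Obj :: "'v set"
  Mor :: "'m set"
  Src :: "'m \<Rightarrow> 'v"
  Rng :: "'m \<Rightarrow> 'v"
  Id :: "'v \<Rightarrow> 'm"
  Comp :: "'m \<Rightarrow> 'm \<Rightarrow> 'm"

text \<open>\<open>Comp C a b\<close> is the composite $ab$, meaningful when $s(a) = r(b)$.\<close>

locale category =
  fixes C :: "('v, 'm) pre_category"
  assumes Src_in: "a \<in> Mor C \<Longrightarrow> Src C a \<in> Obj C"
    and Rng_in: "a \<in> Mor C \<Longrightarrow> Rng C a \<in> Obj C"
    and Id_in: "v \<in> Obj C \<Longrightarrow> Id C v \<in> Mor C"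
    and Src_Id: "v \<in> Obj C \<Longrightarrow> Src C (Id C v) = v"
    and Rng_Id: "v \<in> Obj C \<Longrightarrow> Rng C (Id C v) = v"
    and Comp_in: "\<lbrakk>a \<in> Mor C; b \<in> Mor C; Src C a = Rng C b\<rbrakk> \<Longrightarrow> Comp C a b \<in> Mor C"
    and Src_Comp: "\<lbrakk>a \<in> Mor C; b \<in> Mor C; Src C a = Rng C b\<rbrakk> \<Longrightarrow> Src C (Comp C a b) = Src C b"
    and Rng_Comp: "\<lbrakk>a \<in> Mor C; b \<in> Mor C; Src C a = Rng C b\<rbrakk> \<Longrightarrow> Rng C (Comp C a b) = Rng C a"
    and Comp_Id: "a \<in> Mor C \<Longrightarrow> Comp C a (Id C (Src C a)) = a"
    and Id_Comp: "a \<in> Mor C \<Longrightarrow> Comp C (Id C (Rng C a)) a = a"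
    and Comp_assoc: "\<lbrakk>a \<in> Mor C; b \<in> Mor C; c \<in> Mor C; Src C a = Rng C b; Src C b = Rng C c\<rbrakk>
      \<Longrightarrow> Comp C (Comp C a b) c = Comp C a (Comp C b c)"

definition is_congruence :: "('v, 'm) pre_category \<Rightarrow> ('m \<times> 'm) set \<Rightarrow> bool" where
  "is_congruence C \<theta> \<longleftrightarrow>
     equiv (Mor C) \<theta> \<and>
     (\<forall>(a, b) \<in> \<theta>. Rng C a = Rng C b \<and> Src C a = Src C b) \<and>
     (\<forall>(a, a') \<in> \<theta>. \<forall>(b, b') \<in> \<theta>. Src C a = Rng C b \<longrightarrow> (Comp C a b, Comp C a' b') \<in> \<theta>)"

definition generated_congruence ::
  "('v, 'm) pre_category \<Rightarrow> ('m \<times> 'm) set \<Rightarrow> ('m \<times> 'm) set" where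
  "generated_congruence C R = \<Inter>{\<theta>. is_congruence C \<theta> \<and> R \<subseteq> \<theta>}"

text \<open>Morphisms are congruence classes. When \<open>\<theta>\<close> is a congruence, \<open>Src C ` X\<close> and
  \<open>Rng C ` X\<close> are singletons, and the union defining the composite of two composable classes
  is a single class.\<close>

definition quotient_category ::
  "('v, 'm) pre_category \<Rightarrow> ('m \<times> 'm) set \<Rightarrow> ('v, 'm set) pre_category" where
  "quotient_category C \<theta> =
     \<lparr>Obj = Obj C,
      Mor = Mor C // \<theta>,
      Src = (\<lambda>X. the_elem (Src C ` X)),
      Rng = (\<lambda>X. the_elem (Rng C ` X)),
      Id = (\<lambda>v. \<theta> `` {Id C v}),
      Comp = (\<lambda>X Y. \<Union>x\<in>X. \<Union>y\<in>Y. \<theta> `` {Comp C x y})\<rparr>"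

definition isotropy_group :: "('v, 'm) pre_category \<Rightarrow> 'v \<Rightarrow> 'm monoid" where
  "isotropy_group C v =
     \<lparr>carrier = {a \<in> Mor C. Rng C a = v \<and> Src C a = v}, monoid.mult = Comp C, one = Id C v\<rparr>"


section \<open>k-graphs\<close>

text \<open>The rank is $k = $ \<open>CARD('k)\<close>, which is at least 1 since types are nonempty; the generator
  $e_i$ of $\mathbb{N}^k$ is \<open>axis i 1\<close>. Objects play the role of $\Lambda^0$.\<close>

locale k_graph = category \<Lambda>
  for \<Lambda> :: "('v, 'm) pre_category" +
  fixes d :: "'m \<Rightarrow> nat ^ 'k"
  assumes countable_Mor: "countable (Mor \<Lambda>)"
    and degree_Id: "v \<in> Obj \<Lambda> \<Longrightarrow> d (Id \<Lambda> v) = 0"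
    and degree_Comp: "\<lbrakk>\<mu> \<in> Mor \<Lambda>; \<nu> \<in> Mor \<Lambda>; Src \<Lambda> \<mu> = Rng \<Lambda> \<nu>\<rbrakk>
      \<Longrightarrow> d (Comp \<Lambda> \<mu> \<nu>) = d \<mu> + d \<nu>"
    and factorisation: "\<lbrakk>\<xi> \<in> Mor \<Lambda>; d \<xi> = m + n\<rbrakk>
      \<Longrightarrow> \<exists>!p. case p of (\<mu>, \<nu>) \<Rightarrow>
             \<mu> \<in> Mor \<Lambda> \<and> \<nu> \<in> Mor \<Lambda> \<and> d \<mu> = m \<and> d \<nu> = n \<and>
             Src \<Lambda> \<mu> = Rng \<Lambda> \<nu> \<and> \<xi> = Comp \<Lambda> \<mu> \<nu>"

definition connected_category :: "('v, 'm) pre_category \<Rightarrow> bool" where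
  "connected_category \<Lambda> \<longleftrightarrow>
     (\<forall>u \<in> Obj \<Lambda>. \<forall>w \<in> Obj \<Lambda>.
        equivclp (\<lambda>x y. \<exists>\<xi> \<in> Mor \<Lambda>. Rng \<Lambda> \<xi> = x \<and> Src \<Lambda> \<xi> = y) u w)"

definition morphisms_of_degree ::
  "('v, 'm) pre_category \<Rightarrow> ('m \<Rightarrow> nat ^ 'k) \<Rightarrow> nat ^ 'k \<Rightarrow> 'm set" where
  "morphisms_of_degree \<Lambda> d n = {\<xi> \<in> Mor \<Lambda>. d \<xi> = n}"

text \<open>A digraph's \<open>tail\<close> is the source map $s$ and its \<open>head\<close> is the range map $r$.\<close>

definition skeleton ::
  "('v, 'm) pre_category \<Rightarrow> ('m \<Rightarrow> nat ^ 'k) \<Rightarrow> ('v, 'm) pre_digraph" where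
  "skeleton \<Lambda> d =
     \<lparr>verts = Obj \<Lambda>,
      arcs = (\<Union>i. morphisms_of_degree \<Lambda> d (axis i 1)),
      tail = Src \<Lambda>,
      head = Rng \<Lambda>\<rparr>"


section \<open>Paths and undirected paths\<close>

text \<open>A path is a pair of its range vertex and its list of edges; the vertex is what distinguishes
  the paths of length 0. Composition is left to right, $s(\mu_i) = r(\mu_{i+1})$, which is opposite
  to the walks of \<^theory>\<open>Graph_Theory.Arc_Walk\<close>.\<close>

definition path_category ::
  "('v, 'e) pre_digraph \<Rightarrow> ('v, 'v \<times> 'e list) pre_category" where
  "path_category E =
     \<lparr>Obj = verts E,
      Mor = {(v, es). v \<in> verts E \<and> set es \<subseteq> arcs E \<and> (es \<noteq> [] \<longrightarrow> head E (hd es) = v) \<and>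
                      successively (\<lambda>e f. tail E e = head E f) es},
      Src = (\<lambda>(v, es). if es = [] then v else tail E (last es)),
      Rng = fst,
      Id = (\<lambda>v. (v, [])),
      Comp = (\<lambda>(v, es) (w, fs). (v, es @ fs))\<rparr>"

text \<open>\<open>Neg e\<close> is the formal inverse of \<open>Pos e\<close>. The same letters serve as group generators
  and their inverses.\<close>

datatype 'e signed = Pos 'e | Neg 'e

fun flip :: "'e signed \<Rightarrow> 'e signed" where
  "flip (Pos e) = Neg e"
| "flip (Neg e) = Pos e"

definition signed_letters :: "'e set \<Rightarrow> 'e signed set" where
  "signed_letters X = Pos ` X \<union> Neg ` X"

definition double_graph :: "('v, 'e) pre_digraph \<Rightarrow> ('v, 'e signed) pre_digraph" where
  "double_graph E =
     \<lparr>verts = verts E,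
      arcs = signed_letters (arcs E),
      tail = (\<lambda>x. case x of Pos e \<Rightarrow> tail E e | Neg e \<Rightarrow> head E e),
      head = (\<lambda>x. case x of Pos e \<Rightarrow> head E e | Neg e \<Rightarrow> tail E e)\<rparr>"

abbreviation undirected_paths :: "('v, 'e) pre_digraph \<Rightarrow> ('v, 'v \<times> 'e signed list) pre_category" where
  "undirected_paths E \<equiv> path_category (double_graph E)"

definition reduced :: "'v \<times> 'e signed list \<Rightarrow> bool" where
  "reduced p \<longleftrightarrow> successively (\<lambda>x y. y \<noteq> flip x) (snd p)"


section \<open>Trees\<close>

definition connected_graph :: "('v, 'e) pre_digraph \<Rightarrow> bool" where
  "connected_graph E \<longleftrightarrow>
     (\<forall>u \<in> verts E. \<forall>w \<in> verts E. \<exists>p \<in> Mor (undirected_paths E).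
        Rng (undirected_paths E) p = u \<and> Src (undirected_paths E) p = w)"

text \<open>\<^const>\<open>Digraph_Component.tree\<close> only excludes directed cycles, so it is not usable here.\<close>

definition undirected_tree :: "('v, 'e) pre_digraph \<Rightarrow> bool" where
  "undirected_tree E \<longleftrightarrow>
     wf_digraph E \<and> connected_graph E \<and>
     (\<forall>p \<in> Mor (undirected_paths E).
        reduced p \<and> Src (undirected_paths E) p = Rng (undirected_paths E) p
        \<longrightarrow> p \<in> Id (undirected_paths E) ` verts E)"

definition maximal_spanning_tree ::
  "('v, 'e) pre_digraph \<Rightarrow> ('v, 'e) pre_digraph \<Rightarrow> bool" where
  "maximal_spanning_tree T E \<longleftrightarrow> subgraph T E \<and> undirected_tree T \<and> verts T = verts E"


section \<open>The fundamental groupoid and group\<close>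

definition cancellation_relations ::
  "('v, 'e) pre_digraph \<Rightarrow> (('v \<times> 'e signed list) \<times> ('v \<times> 'e signed list)) set" where
  "cancellation_relations E =
     {((tail (double_graph E) x, [flip x, x]), (tail (double_graph E) x, [])) |x.
        x \<in> arcs (double_graph E)}"

definition commuting_squares ::
  "('v, 'm) pre_category \<Rightarrow> ('m \<Rightarrow> nat ^ 'k) \<Rightarrow> ('m list \<times> 'm list) set" where
  "commuting_squares \<Lambda> d =
     {([f, g], [g', f']) |f g g' f'. \<exists>i j. i \<noteq> j \<and>
        f \<in> morphisms_of_degree \<Lambda> d (axis i 1) \<and> f' \<in> morphisms_of_degree \<Lambda> d (axis i 1) \<and>
        g \<in> morphisms_of_degree \<Lambda> d (axis j 1) \<and> g' \<in> morphisms_of_degree \<Lambda> d (axis j 1) \<and>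
        Src \<Lambda> f = Rng \<Lambda> g \<and> Src \<Lambda> g' = Rng \<Lambda> f' \<and> Comp \<Lambda> f g = Comp \<Lambda> g' f'}"

definition square_step ::
  "('v, 'm) pre_category \<Rightarrow> ('m \<Rightarrow> nat ^ 'k) \<Rightarrow> 'v \<times> 'm list \<Rightarrow> 'v \<times> 'm list \<Rightarrow> bool" where
  "square_step \<Lambda> d p q \<longleftrightarrow>
     p \<in> Mor (path_category (skeleton \<Lambda> d)) \<and> q \<in> Mor (path_category (skeleton \<Lambda> d)) \<and>
     (\<exists>v xs ys a b. (a, b) \<in> commuting_squares \<Lambda> d \<and> p = (v, xs @ a @ ys) \<and> q = (v, xs @ b @ ys))"

definition square_equivalence ::
  "('v, 'm) pre_category \<Rightarrow> ('m \<Rightarrow> nat ^ 'k) \<Rightarrow> (('v \<times> 'm list) \<times> ('v \<times> 'm list)) set" where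
  "square_equivalence \<Lambda> d =
     {(p, q). p \<in> Mor (path_category (skeleton \<Lambda> d)) \<and> q \<in> Mor (path_category (skeleton \<Lambda> d)) \<and>
              equivclp (square_step \<Lambda> d) p q}"

text \<open>The relation $S^+$; directed paths are embedded among the undirected ones by \<open>Pos\<close>. The path
  $f^{-1}e^{-1}$ has range $s(f)$.\<close>

definition square_relations ::
  "('v, 'm) pre_category \<Rightarrow> ('m \<Rightarrow> nat ^ 'k)
     \<Rightarrow> (('v \<times> 'm signed list) \<times> ('v \<times> 'm signed list)) set" where
  "square_relations \<Lambda> d =
     {((v, map Pos es), (w, map Pos fs)) |v es w fs. ((v, es), (w, fs)) \<in> square_equivalence \<Lambda> d} \<union>
     {((Src \<Lambda> f, [Neg f, Neg e]), (Src \<Lambda> h, [Neg h, Neg g])) |e f g h v w.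
        ((v, [e, f]), (w, [g, h])) \<in> square_equivalence \<Lambda> d}"

definition fundamental_groupoid ::
  "('v, 'm) pre_category \<Rightarrow> ('m \<Rightarrow> nat ^ 'k) \<Rightarrow> ('v, ('v \<times> 'm signed list) set) pre_category" where
  "fundamental_groupoid \<Lambda> d =
     quotient_category (undirected_paths (skeleton \<Lambda> d))
       (generated_congruence (undirected_paths (skeleton \<Lambda> d))
          (cancellation_relations (skeleton \<Lambda> d) \<union> square_relations \<Lambda> d))"

definition fundamental_group ::
  "('v, 'm) pre_category \<Rightarrow> ('m \<Rightarrow> nat ^ 'k) \<Rightarrow> 'v \<Rightarrow> ('v \<times> 'm signed list) set monoid" where
  "fundamental_group \<Lambda> d v = isotropy_group (fundamental_groupoid \<Lambda> d) v"


section \<open>Group presentations\<close>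

text \<open>The group presented by generators \<open>X\<close> and relations \<open>R\<close> (pairs of words in $X \cup X^{-1}$):
  words modulo the smallest congruence of the word monoid that contains \<open>R\<close> and free
  cancellation.\<close>

definition is_word_congruence :: "'x set \<Rightarrow> ('x signed list \<times> 'x signed list) set \<Rightarrow> bool" where
  "is_word_congruence X \<theta> \<longleftrightarrow>
     equiv (lists (signed_letters X)) \<theta> \<and>
     (\<forall>(a, a') \<in> \<theta>. \<forall>(b, b') \<in> \<theta>. (a @ b, a' @ b') \<in> \<theta>) \<and>
     (\<forall>x \<in> signed_letters X. ([flip x, x], []) \<in> \<theta>)"

definition presentation_congruence ::
  "'x set \<Rightarrow> ('x signed list \<times> 'x signed list) set \<Rightarrow> ('x signed list \<times> 'x signed list) set" where
  "presentation_congruence X R = \<Inter>{\<theta>. is_word_congruence X \<theta> \<and> R \<subseteq> \<theta>}"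

definition presented_group ::
  "'x set \<Rightarrow> ('x signed list \<times> 'x signed list) set \<Rightarrow> 'x signed list set monoid" where
  "presented_group X R =
     (let \<theta> = presentation_congruence X R in
       \<lparr>carrier = lists (signed_letters X) // \<theta>,
        monoid.mult = (\<lambda>A B. \<Union>a\<in>A. \<Union>b\<in>B. \<theta> `` {a @ b}),
        one = \<theta> `` {[]}\<rparr>)"

definition tree_relations ::
  "('v, 'm) pre_digraph \<Rightarrow> ('m signed list \<times> 'm signed list) set" where
  "tree_relations T = {([Pos t], []) |t. t \<in> arcs T}"

definition square_words ::
  "('v, 'm) pre_category \<Rightarrow> ('m \<Rightarrow> nat ^ 'k) \<Rightarrow> ('m signed list \<times> 'm signed list) set" where
  "square_words \<Lambda> d =
     {([x, y], [z, w]) |x y z w u u'. ((u, [x, y]), (u', [z, w])) \<in> square_relations \<Lambda> d}"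


section \<open>Both sides are groups\<close>

subsection \<open>Generated congruences and quotients\<close>

lemma is_congruence_generated:
  assumes "category C"
    and par: "\<And>a b. (a, b) \<in> R \<Longrightarrow> a \<in> Mor C \<and> b \<in> Mor C \<and> Rng C a = Rng C b \<and> Src C a = Src C b"
  shows "is_congruence C (generated_congruence C R)" "R \<subseteq> generated_congruence C R"
proof -
  interpret category C by fact
  let ?P = "{(a, b). a \<in> Mor C \<and> b \<in> Mor C \<and> Rng C a = Rng C b \<and> Src C a = Src C b}"
  have P: "is_congruence C ?P" "R \<subseteq> ?P"
    unfolding is_congruence_def equiv_def refl_on_def sym_def trans_def
    using par by (auto simp: Comp_in Src_Comp Rng_Comp)
  show "R \<subseteq> generated_congruence C R" by (auto simp: generated_congruence_def)
  have sub: "generated_congruence C R \<subseteq> ?P" using P by (auto simp: generated_congruence_def)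
  have each: "equiv (Mor C) \<theta>"
     "\<And>a b a' b'. (a, a') \<in> \<theta> \<Longrightarrow> (b, b') \<in> \<theta> \<Longrightarrow> Src C a = Rng C b \<Longrightarrow> (Comp C a b, Comp C a' b') \<in> \<theta>"
    if "is_congruence C \<theta>" for \<theta> using that unfolding is_congruence_def by blast+
  have "equiv (Mor C) (generated_congruence C R)"
  proof (rule equivI)
    show "generated_congruence C R \<subseteq> Mor C \<times> Mor C" using sub by auto
    show "refl_on (Mor C) (generated_congruence C R)"
      using each(1) unfolding generated_congruence_def refl_on_def equiv_def by blast
    show "sym (generated_congruence C R)"
      using each(1) unfolding generated_congruence_def equiv_def sym_def by blast
    show "trans (generated_congruence C R)"
      using each(1) unfolding generated_congruence_def equiv_def trans_def by blast
  qed
  moreover have "(Comp C a b, Comp C a' b') \<in> generated_congruence C R"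
    if "(a, a') \<in> generated_congruence C R" "(b, b') \<in> generated_congruence C R" "Src C a = Rng C b"
    for a b a' b'
    using that each(2) unfolding generated_congruence_def by blast
  ultimately show "is_congruence C (generated_congruence C R)"
    using sub unfolding is_congruence_def by blast
qed

locale category_congruence = category C for C :: "('v, 'm) pre_category" +
  fixes \<theta> assumes congruence: "is_congruence C \<theta>"
begin

abbreviation "Q \<equiv> quotient_category C \<theta>"

lemma equiv_cong: "equiv (Mor C) \<theta>"
  using congruence by (simp add: is_congruence_def)

lemma cong_par: "(a, b) \<in> \<theta> \<Longrightarrow> Rng C a = Rng C b \<and> Src C a = Src C b"
  using congruence unfolding is_congruence_def by blast

lemma cong_Comp: "(a, a') \<in> \<theta> \<Longrightarrow> (b, b') \<in> \<theta> \<Longrightarrow> Src C a = Rng C b \<Longrightarrow> (Comp C a b, Comp C a' b') \<in> \<theta>"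
  using congruence unfolding is_congruence_def by blast

lemma cong_refl: "a \<in> Mor C \<Longrightarrow> (a, a) \<in> \<theta>"
  using equiv_cong by (auto simp: equiv_def refl_on_def)

lemma class_eq_iff: "a \<in> Mor C \<Longrightarrow> b \<in> Mor C \<Longrightarrow> \<theta> `` {a} = \<theta> `` {b} \<longleftrightarrow> (a, b) \<in> \<theta>"
  using eq_equiv_class_iff[OF equiv_cong] by simp

lemma Mor_Q: "Mor Q = (\<lambda>a. \<theta> `` {a}) ` Mor C"
  by (auto simp: quotient_category_def quotient_def)

lemma Obj_Q: "Obj Q = Obj C" by (simp add: quotient_category_def)

lemma Id_Q: "Id Q v = \<theta> `` {Id C v}" by (simp add: quotient_category_def)

lemma Src_Q: assumes "a \<in> Mor C" shows "Src Q (\<theta> `` {a}) = Src C a"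
proof -
  have "Src C b = Src C a" if "b \<in> \<theta> `` {a}" for b
    using that cong_par by (metis Image_singleton_iff)
  moreover have "a \<in> \<theta> `` {a}" using cong_refl[OF assms] by simp
  ultimately have "Src C ` (\<theta> `` {a}) = {Src C a}" by blast
  then show ?thesis by (simp add: quotient_category_def)
qed

lemma Rng_Q: assumes "a \<in> Mor C" shows "Rng Q (\<theta> `` {a}) = Rng C a"
proof -
  have "Rng C b = Rng C a" if "b \<in> \<theta> `` {a}" for b
    using that cong_par by (metis Image_singleton_iff)
  moreover have "a \<in> \<theta> `` {a}" using cong_refl[OF assms] by simp
  ultimately have "Rng C ` (\<theta> `` {a}) = {Rng C a}" by blast
  then show ?thesis by (simp add: quotient_category_def)
qed

lemma Comp_Q:
  assumes "a \<in> Mor C" "b \<in> Mor C" "Src C a = Rng C b"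
  shows "Comp Q (\<theta> `` {a}) (\<theta> `` {b}) = \<theta> `` {Comp C a b}"
proof -
  have "\<theta> `` {Comp C x y} = \<theta> `` {Comp C a b}" if "(a, x) \<in> \<theta>" "(b, y) \<in> \<theta>" for x y
    using cong_Comp[OF that assms(3)] equiv_class_eq[OF equiv_cong] by metis
  then have "(\<Union>x\<in>\<theta> `` {a}. \<Union>y\<in>\<theta> `` {b}. \<theta> `` {Comp C x y}) =
      (\<Union>x\<in>\<theta> `` {a}. \<Union>y\<in>\<theta> `` {b}. \<theta> `` {Comp C a b})"
    by (intro SUP_cong refl) auto
  moreover have "\<theta> `` {a} \<noteq> {}" "\<theta> `` {b} \<noteq> {}" using cong_refl assms by blast+
  ultimately have "(\<Union>x\<in>\<theta> `` {a}. \<Union>y\<in>\<theta> `` {b}. \<theta> `` {Comp C x y}) = \<theta> `` {Comp C a b}"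
    by simp
  then show ?thesis by (simp add: quotient_category_def)
qed

lemma category_Q: "category Q"
  by (unfold_locales; (unfold Mor_Q Obj_Q Id_Q; (elim imageE; hypsubst)?);
      simp add: Src_Q Rng_Q Comp_Q Src_in Rng_in Id_in Src_Id Rng_Id Comp_in
        Src_Comp Rng_Comp Comp_Id Id_Comp Comp_assoc)

end

lemma group_isotropy_group:
  assumes "category C" "v \<in> Obj C"
    and inv: "\<And>a. a \<in> Mor C \<Longrightarrow> \<exists>b \<in> Mor C. Src C b = Rng C a \<and> Rng C b = Src C a \<and> Comp C b a = Id C (Src C a)"
  shows "group (isotropy_group C v)"
proof -
  interpret category C by fact
  show ?thesis
  proof (rule groupI)
    fix a assume "a \<in> carrier (isotropy_group C v)"
    then show "\<exists>b \<in> carrier (isotropy_group C v). b \<otimes>\<^bsub>isotropy_group C v\<^esub> a = \<one>\<^bsub>isotropy_group C v\<^esub>"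
      using inv by (fastforce simp: isotropy_group_def)
    show "\<one>\<^bsub>isotropy_group C v\<^esub> \<otimes>\<^bsub>isotropy_group C v\<^esub> a = a"
      using Id_Comp \<open>a \<in> _\<close> by (auto simp: isotropy_group_def)
  qed (use \<open>v \<in> _\<close> in \<open>auto simp: isotropy_group_def Comp_in Src_Comp Rng_Comp Comp_assoc Id_in Src_Id Rng_Id\<close>)
qed

subsection \<open>Path categories\<close>

lemma category_path_category:
  assumes "wf_digraph E" shows "category (path_category E)"
proof -
  interpret wf_digraph E by fact
  have Mor: "(v, es) \<in> Mor (path_category E) \<longleftrightarrow> v \<in> verts E \<and> set es \<subseteq> arcs E \<and>
      (es \<noteq> [] \<longrightarrow> head E (hd es) = v) \<and> successively (\<lambda>e f. tail E e = head E f) es" for v es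
    by (simp add: path_category_def)
  have Src: "Src (path_category E) (v, es) = (if es = [] then v else tail E (last es))" for v es
    by (simp add: path_category_def)
  have other: "Obj (path_category E) = verts E" "Rng (path_category E) (v, es) = v"
    "Id (path_category E) v = (v, [])" "Comp (path_category E) (v, es) (w, fs) = (v, es @ fs)" for v es w fs
    by (simp_all add: path_category_def)
  have last: "es \<noteq> [] \<Longrightarrow> set es \<subseteq> arcs E \<Longrightarrow> tail E (last es) \<in> verts E" for es
    using last_in_set tail_in_verts by blast
  show ?thesis
    by (unfold_locales; (simp only: split_paired_all)?;
        auto simp: Mor Src other last successively_append_iff split: if_splits)
qed

lemma wf_double_graph: assumes "wf_digraph E" shows "wf_digraph (double_graph E)"
proof -
  interpret wf_digraph E by fact
  show ?thesis by unfold_locales (auto simp: double_graph_def signed_letters_def)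
qed

lemma wf_skeleton: assumes "k_graph \<Lambda> d" shows "wf_digraph (skeleton \<Lambda> d)"
proof -
  interpret k_graph \<Lambda> d by fact
  show ?thesis
    by unfold_locales (auto simp: skeleton_def morphisms_of_degree_def Src_in Rng_in)
qed

lemma square_step_endpoints:
  assumes "square_step \<Lambda> d p q" "k_graph \<Lambda> d"
  shows "fst p = fst q \<and> Src (path_category (skeleton \<Lambda> d)) p = Src (path_category (skeleton \<Lambda> d)) q
    \<and> length (snd p) = length (snd q)"
proof -
  interpret k_graph \<Lambda> d by fact
  obtain v xs ys f g g' f' where *: "([f, g], [g', f']) \<in> commuting_squares \<Lambda> d"
    "p = (v, xs @ [f, g] @ ys)" "q = (v, xs @ [g', f'] @ ys)"
    using assms(1) unfolding square_step_def commuting_squares_def by blast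
  from *(1) have "Src \<Lambda> g = Src \<Lambda> f'"
    unfolding commuting_squares_def morphisms_of_degree_def
    by clarsimp (metis Src_Comp)
  with * show ?thesis by (auto simp: path_category_def skeleton_def)
qed

lemma square_equivalence_endpoints:
  assumes "(p, q) \<in> square_equivalence \<Lambda> d" "k_graph \<Lambda> d"
  shows "fst p = fst q \<and> Src (path_category (skeleton \<Lambda> d)) p = Src (path_category (skeleton \<Lambda> d)) q
    \<and> length (snd p) = length (snd q)"
proof -
  have "equivclp (square_step \<Lambda> d) p q" using assms by (simp add: square_equivalence_def)
  then show ?thesis
    by (induction rule: equivclp_induct) (simp, metis square_step_endpoints[OF _ assms(2)])
qed

lemma relations_parallel:
  assumes "k_graph \<Lambda> d" "(p, q) \<in> cancellation_relations (skeleton \<Lambda> d) \<union> square_relations \<Lambda> d"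
  defines "C \<equiv> undirected_paths (skeleton \<Lambda> d)"
  shows "p \<in> Mor C \<and> q \<in> Mor C \<and> Rng C p = Rng C q \<and> Src C p = Src C q"
proof -
  interpret k_graph \<Lambda> d by fact
  interpret E: wf_digraph "skeleton \<Lambda> d" using wf_skeleton assms(1) .
  interpret D: wf_digraph "double_graph (skeleton \<Lambda> d)" using wf_double_graph E.wf_digraph .
  let ?S = "square_equivalence \<Lambda> d"
  have PM: "(v, map Pos es) \<in> Mor C \<longleftrightarrow> (v, es) \<in> Mor (path_category (skeleton \<Lambda> d))" for v es
    by (auto simp: C_def path_category_def double_graph_def signed_letters_def successively_map hd_map)
  have PS: "Src C (v, map Pos es) = Src (path_category (skeleton \<Lambda> d)) (v, es)" for v es
    by (auto simp: C_def path_category_def double_graph_def last_map)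
  consider (c) "(p, q) \<in> cancellation_relations (skeleton \<Lambda> d)"
    | (s) v es w fs where "p = (v, map Pos es)" "q = (w, map Pos fs)" "((v, es), (w, fs)) \<in> ?S"
    | (i) e f g h v w where "p = (Src \<Lambda> f, [Neg f, Neg e])" "q = (Src \<Lambda> h, [Neg h, Neg g])"
        "((v, [e, f]), (w, [g, h])) \<in> ?S"
    using assms(2) unfolding square_relations_def by blast
  then show ?thesis
  proof cases
    case c
    then obtain x where x: "p = (tail (double_graph (skeleton \<Lambda> d)) x, [flip x, x])"
      "q = (tail (double_graph (skeleton \<Lambda> d)) x, [])" "x \<in> arcs (double_graph (skeleton \<Lambda> d))"
      by (auto simp: cancellation_relations_def)
    with D.tail_in_verts[OF x(3)] show ?thesis
      by (cases x) (auto simp: C_def path_category_def double_graph_def signed_letters_def)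
  next
    case s
    with square_equivalence_endpoints[OF s(3) assms(1)] show ?thesis
      by (simp add: PM PS) (auto simp: C_def path_category_def square_equivalence_def)
  next
    case i
    have *: "(v, [e, f]) \<in> Mor (path_category (skeleton \<Lambda> d))"
            "(w, [g, h]) \<in> Mor (path_category (skeleton \<Lambda> d))"
      using i(3) by (auto simp: square_equivalence_def)
    have arcsin: "f \<in> arcs (skeleton \<Lambda> d)" "h \<in> arcs (skeleton \<Lambda> d)"
      using * by (auto simp: path_category_def)
    have "Src \<Lambda> f = tail (skeleton \<Lambda> d) f" "Src \<Lambda> h = tail (skeleton \<Lambda> d) h" by (auto simp: skeleton_def)
    with * i square_equivalence_endpoints[OF i(3) assms(1)] E.tail_in_verts[OF arcsin(1)]  E.tail_in_verts[OF arcsin(2)]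
    show ?thesis
      by (auto simp: C_def path_category_def double_graph_def signed_letters_def)
  qed
qed

lemma group_fundamental_group:
  assumes "k_graph \<Lambda> d" "v \<in> Obj \<Lambda>"
  shows "group (fundamental_group \<Lambda> d v)"
proof -
  let ?E = "skeleton \<Lambda> d" let ?C = "undirected_paths ?E"
  let ?R = "cancellation_relations ?E \<union> square_relations \<Lambda> d"
  let ?\<theta> = "generated_congruence ?C ?R"
  have wf: "wf_digraph (double_graph ?E)"
    using wf_skeleton assms wf_double_graph by blast
  interpret C: category ?C using category_path_category wf .
  interpret category_congruence ?C ?\<theta>
    by unfold_locales (use is_congruence_generated(1)[OF C.category_axioms] relations_parallel[OF assms(1)] in blast)
  interpret Q: category Q by (rule category_Q)
  have R: "?R \<subseteq> ?\<theta>"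
    using is_congruence_generated(2)[OF C.category_axioms] relations_parallel[OF assms(1)] by blast
  have inv: "\<exists>q. q \<in> Mor ?C \<and> Rng ?C q = Src ?C p \<and> Src ?C q = Rng ?C p \<and> (Comp ?C q p, Id ?C (Src ?C p)) \<in> ?\<theta>"
    if "p \<in> Mor ?C" for p
  proof -
    have "\<forall>v. (v, es) \<in> Mor ?C \<longrightarrow> (\<exists>q. q \<in> Mor ?C \<and> Rng ?C q = Src ?C (v, es) \<and> Src ?C q = Rng ?C (v, es)
            \<and> (Comp ?C q (v, es), Id ?C (Src ?C (v, es))) \<in> ?\<theta>)" for es
    proof (induction es)
      case Nil
      show ?case
      proof (intro allI impI)
        fix v assume v: "(v, []) \<in> Mor ?C"
        then have "((v, []), (v, [])) \<in> ?\<theta>" using cong_refl by blast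
        with v show "\<exists>q. q \<in> Mor ?C \<and> Rng ?C q = Src ?C (v, []) \<and> Src ?C q = Rng ?C (v, [])
            \<and> (Comp ?C q (v, []), Id ?C (Src ?C (v, []))) \<in> ?\<theta>"
          by (intro exI[of _ "(v, [])"]) (auto simp: path_category_def)
      qed
    next
      case (Cons x es)
      show ?case
      proof (intro allI impI)
        fix v assume v: "(v, x # es) \<in> Mor ?C"
        let ?D = "double_graph ?E" let ?t = "tail ?D x"
        have x: "x \<in> arcs ?D" "v = head ?D x" and tv: "?t \<in> verts ?D" "v \<in> verts ?D"
          using v wf by (auto simp: path_category_def wf_digraph_def)
        have fx: "flip x \<in> arcs ?D" "head ?D (flip x) = ?t" "tail ?D (flip x) = v"
          using x by (cases x; auto simp: double_graph_def signed_letters_def)+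
        have p': "(?t, es) \<in> Mor ?C" "Src ?C (?t, es) = Src ?C (v, x # es)"
          using v tv by (auto simp: path_category_def successively_Cons)
        obtain w qs where q: "(w, qs) \<in> Mor ?C" "Rng ?C (w, qs) = Src ?C (?t, es)" "Src ?C (w, qs) = Rng ?C (?t, es)"
          "(Comp ?C (w, qs) (?t, es), Id ?C (Src ?C (?t, es))) \<in> ?\<theta>"
          using Cons p' by (metis surj_pair)
        have m: "(?t, [flip x]) \<in> Mor ?C" "Src ?C (?t, [flip x]) = v" "Rng ?C (?t, [flip x]) = ?t"
          using fx tv by (auto simp: path_category_def)
        have Rt: "Rng ?C (u, ys) = u" for u ys by (simp add: path_category_def)
        note Rw = Rt
        let ?q = "Comp ?C (w, qs) (?t, [flip x])"
        have qe: "?q \<in> Mor ?C" "Src ?C ?q = v" "Rng ?C ?q = w"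
          using C.Comp_in[OF q(1) m(1)] C.Src_Comp[OF q(1) m(1)] C.Rng_Comp[OF q(1) m(1)] q(3) m(2,3) Rt Rw
          by simp_all
        have cc: "((?t, [flip x, x]), (?t, [])) \<in> ?\<theta>"
          using R x by (auto simp: cancellation_relations_def)
        have 1: "(Comp ?C (?t, [flip x, x]) (?t, es), Comp ?C (?t, []) (?t, es)) \<in> ?\<theta>"
          using cong_Comp[OF cc cong_refl[OF p'(1)]] by (auto simp: path_category_def)
        have 2: "(Comp ?C (w, qs) (Comp ?C (?t, [flip x, x]) (?t, es)), Comp ?C (w, qs) (Comp ?C (?t, []) (?t, es))) \<in> ?\<theta>"
          using cong_Comp[OF cong_refl[OF q(1)] 1] q(3) by (auto simp: path_category_def)
        have "Comp ?C (w, qs) (Comp ?C (?t, [flip x, x]) (?t, es)) = Comp ?C ?q (v, x # es)"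
          "Comp ?C (w, qs) (Comp ?C (?t, []) (?t, es)) = Comp ?C (w, qs) (?t, es)"
          by (auto simp: path_category_def)
        with 2 q(4) have "(Comp ?C ?q (v, x # es), Id ?C (Src ?C (?t, es))) \<in> ?\<theta>"
          using equiv_cong by (auto simp: equiv_def dest: transD)
        with qe q p' show "\<exists>q. q \<in> Mor ?C \<and> Rng ?C q = Src ?C (v, x # es) \<and> Src ?C q = Rng ?C (v, x # es)
            \<and> (Comp ?C q (v, x # es), Id ?C (Src ?C (v, x # es))) \<in> ?\<theta>"
          by (intro exI[of _ ?q]) (auto simp: path_category_def)
      qed
    qed
    then show ?thesis using that by (cases p) blast
  qed
  have "group (isotropy_group Q v)"
  proof (rule group_isotropy_group[OF category_Q])
    show "v \<in> Obj Q" unfolding Obj_Q using assms by (simp add: path_category_def double_graph_def skeleton_def)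
    fix a assume "a \<in> Mor Q"
    then obtain p where p: "a = ?\<theta> `` {p}" "p \<in> Mor ?C" by (auto simp: Mor_Q)
    from inv[OF p(2)] obtain q where q: "q \<in> Mor ?C" "Rng ?C q = Src ?C p" "Src ?C q = Rng ?C p"
       "(Comp ?C q p, Id ?C (Src ?C p)) \<in> ?\<theta>" by blast
    have "Comp Q (?\<theta> `` {q}) a = Id Q (Src Q a)"
      using p q equiv_class_eq[OF equiv_cong q(4)] by (simp add: Comp_Q Src_Q Id_Q)
    then show "\<exists>b \<in> Mor Q. Src Q b = Rng Q a \<and> Rng Q b = Src Q a \<and> Comp Q b a = Id Q (Src Q a)"
      using p q by (intro bexI[of _ "?\<theta> `` {q}"]) (auto simp: Src_Q Rng_Q Mor_Q)
  qed
  then show ?thesis by (simp add: fundamental_group_def fundamental_groupoid_def)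
qed

subsection \<open>Presented groups\<close>

lemma is_word_congruence_presentation:
  assumes R: "R \<subseteq> lists (signed_letters X) \<times> lists (signed_letters X)"
  shows "is_word_congruence X (presentation_congruence X R)"
proof -
  let ?W = "lists (signed_letters X)" let ?\<theta> = "presentation_congruence X R"
  have flip: "flip x \<in> signed_letters X" if "x \<in> signed_letters X" for x
    using that by (auto simp: signed_letters_def)
  have "is_word_congruence X (?W \<times> ?W)"
    using flip by (auto simp: is_word_congruence_def equiv_def refl_on_def sym_def trans_def)
  with R have sub: "?\<theta> \<subseteq> ?W \<times> ?W" unfolding presentation_congruence_def by blast
  have each: "equiv ?W \<theta>"
    "\<And>a a' b b'. (a, a') \<in> \<theta> \<Longrightarrow> (b, b') \<in> \<theta> \<Longrightarrow> (a @ b, a' @ b') \<in> \<theta>"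
    "\<And>x. x \<in> signed_letters X \<Longrightarrow> ([flip x, x], []) \<in> \<theta>"
    if "is_word_congruence X \<theta>" for \<theta> using that unfolding is_word_congruence_def by blast+
  have "equiv ?W ?\<theta>"
  proof (rule equivI)
    show "refl_on ?W ?\<theta>"
      using each(1) unfolding presentation_congruence_def refl_on_def equiv_def by blast
    show "sym ?\<theta>" using each(1) unfolding presentation_congruence_def equiv_def sym_def by blast
    show "trans ?\<theta>" using each(1) unfolding presentation_congruence_def equiv_def trans_def by blast
  qed (rule sub)
  moreover have "(a @ b, a' @ b') \<in> ?\<theta>" if "(a, a') \<in> ?\<theta>" "(b, b') \<in> ?\<theta>" for a a' b b'
    using that each(2) unfolding presentation_congruence_def by blast
  moreover have "([flip x, x], []) \<in> ?\<theta>" if "x \<in> signed_letters X" for x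
    using that each(3) unfolding presentation_congruence_def by blast
  ultimately show ?thesis unfolding is_word_congruence_def by blast
qed

lemma group_presented_group:
  assumes R: "R \<subseteq> lists (signed_letters X) \<times> lists (signed_letters X)"
  shows "group (presented_group X R)"
proof -
  let ?W = "lists (signed_letters X)" let ?\<theta> = "presentation_congruence X R"
  let ?G = "presented_group X R"
  note c = is_word_congruence_presentation[OF R, unfolded is_word_congruence_def]
  have eq: "equiv ?W ?\<theta>" using c by blast
  have app: "(a @ b, a' @ b') \<in> ?\<theta>" if "(a, a') \<in> ?\<theta>" "(b, b') \<in> ?\<theta>" for a a' b b'
    using c that by blast
  have canc: "([flip x, x], []) \<in> ?\<theta>" if "x \<in> signed_letters X" for x using c that by blast
  have refl: "(a, a) \<in> ?\<theta>" if "a \<in> ?W" for a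
    using eq that by (auto simp: equiv_def refl_on_def)
  have carrier: "carrier ?G = (\<lambda>a. ?\<theta> `` {a}) ` ?W"
    by (auto simp: presented_group_def Let_def quotient_def)
  have one: "\<one>\<^bsub>?G\<^esub> = ?\<theta> `` {[]}" by (simp add: presented_group_def Let_def)
  have mult: "?\<theta> `` {a} \<otimes>\<^bsub>?G\<^esub> ?\<theta> `` {b} = ?\<theta> `` {a @ b}" if "a \<in> ?W" "b \<in> ?W" for a b
  proof -
    have "?\<theta> `` {x @ y} = ?\<theta> `` {a @ b}" if "(a, x) \<in> ?\<theta>" "(b, y) \<in> ?\<theta>" for x y
      using app[OF that] equiv_class_eq[OF eq] by metis
    then have "(\<Union>x\<in>?\<theta> `` {a}. \<Union>y\<in>?\<theta> `` {b}. ?\<theta> `` {x @ y}) =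
        (\<Union>x\<in>?\<theta> `` {a}. \<Union>y\<in>?\<theta> `` {b}. ?\<theta> `` {a @ b})"
      by (intro SUP_cong refl) auto
    moreover have "?\<theta> `` {a} \<noteq> {}" "?\<theta> `` {b} \<noteq> {}" using refl that by blast+
    ultimately show ?thesis by (simp add: presented_group_def Let_def)
  qed
  have inv: "\<exists>b \<in> ?W. (b @ a, []) \<in> ?\<theta>" if "a \<in> ?W" for a
    using that
  proof (induction a)
    case Nil then show ?case using refl[of "[]"] by force
  next
    case (Cons x a)
    then obtain b where b: "b \<in> ?W" "(b @ a, []) \<in> ?\<theta>" by auto
    have x: "x \<in> signed_letters X" "flip x \<in> signed_letters X" and a: "a \<in> ?W"
      using Cons by (auto simp: signed_letters_def)
    have "(b @ [flip x, x] @ a, b @ [] @ a) \<in> ?\<theta>"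
      by (intro app refl b a canc x)
    with b have "(b @ [flip x, x] @ a, []) \<in> ?\<theta>"
      using eq by (auto simp: equiv_def dest: transD)
    with b x show ?case by (intro bexI[of _ "b @ [flip x]"]) auto
  qed
  show ?thesis
  proof (rule groupI)
    fix A assume "A \<in> carrier ?G"
    then obtain a where a: "A = ?\<theta> `` {a}" "a \<in> ?W" unfolding carrier by blast
    then obtain b where b: "b \<in> ?W" "(b @ a, []) \<in> ?\<theta>" using inv by blast
    then show "\<exists>B \<in> carrier ?G. B \<otimes>\<^bsub>?G\<^esub> A = \<one>\<^bsub>?G\<^esub>"
      using a equiv_class_eq[OF eq b(2)] by (auto simp: carrier one mult)
    show "\<one>\<^bsub>?G\<^esub> \<otimes>\<^bsub>?G\<^esub> A = A"
      using a mult[of "[]" a] by (simp add: one)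
  next
    show "\<one>\<^bsub>?G\<^esub> \<in> carrier ?G" by (auto simp: carrier one)
  next
    fix A B assume "A \<in> carrier ?G" "B \<in> carrier ?G"
    then show "A \<otimes>\<^bsub>?G\<^esub> B \<in> carrier ?G"
      unfolding carrier by (elim imageE) (simp only: mult append_in_lists_conv image_eqI)
  next
    fix A B D assume "A \<in> carrier ?G" "B \<in> carrier ?G" "D \<in> carrier ?G"
    then show "(A \<otimes>\<^bsub>?G\<^esub> B) \<otimes>\<^bsub>?G\<^esub> D = A \<otimes>\<^bsub>?G\<^esub> (B \<otimes>\<^bsub>?G\<^esub> D)"
      unfolding carrier by (elim imageE) (simp only: mult append_in_lists_conv append_assoc simp_thms)
  qed
qed

lemma presentation_words:
  assumes "k_graph \<Lambda> d" "maximal_spanning_tree T (skeleton \<Lambda> d)"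
  shows "tree_relations T \<union> square_words \<Lambda> d \<subseteq>
    lists (signed_letters (arcs (skeleton \<Lambda> d))) \<times> lists (signed_letters (arcs (skeleton \<Lambda> d)))"
proof -
  have "arcs T \<subseteq> arcs (skeleton \<Lambda> d)"
    using assms(2) by (simp add: maximal_spanning_tree_def subgraph_def)
  then have "tree_relations T \<subseteq>
      lists (signed_letters (arcs (skeleton \<Lambda> d))) \<times> lists (signed_letters (arcs (skeleton \<Lambda> d)))"
    by (auto simp: tree_relations_def signed_letters_def)
  moreover have "set (snd p) \<subseteq> signed_letters (arcs (skeleton \<Lambda> d)) \<and>
      set (snd q) \<subseteq> signed_letters (arcs (skeleton \<Lambda> d))"
    if "(p, q) \<in> square_relations \<Lambda> d" for p q
    using relations_parallel[OF assms(1), of p q] that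
    by (auto simp: path_category_def double_graph_def)
  then have "square_words \<Lambda> d \<subseteq>
      lists (signed_letters (arcs (skeleton \<Lambda> d))) \<times> lists (signed_letters (arcs (skeleton \<Lambda> d)))"
    unfolding square_words_def by fastforce
  ultimately show ?thesis by blast
qed

end

theory Submission
  imports Defs
begin

text \<open>Choose for every vertex \<open>u\<close> an undirected path \<open>branch u\<close> in the tree with range \<open>v\<close> and
  source \<open>u\<close>. Reading off the word of a closed path induces a homomorphism from the isotropy group
  to the presented group. Sending a letter \<open>x\<close> to the closed path
  $\mathit{branch}(r(x))\; x\; \mathit{branch}(s(x))^{-1}$ gives its inverse: on a path from \<open>u\<close> to
  \<open>w\<close> the connecting branches cancel, so the path is only conjugated by the two outer branches, and a
  letter of the tree is sent to a closed path of the tree, which cancels completely. Conversely the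
  branches are trivial words modulo the tree relations. The relations in $S^+$ between paths
  of length other than two are consequences of those between paths of length two.\<close>

section \<open>Paths between two vertices\<close>

text \<open>Peeling edges off the front suits the inductions below better than the
  \<open>hd\<close>, \<open>last\<close> and \<open>successively\<close> conditions of
  \<open>path_category\<close>. Membership in the vertex set is asked only at the source end; in a
  well-formed graph it follows at all other vertices.\<close>

primrec path_between :: "('v, 'e) pre_digraph \<Rightarrow> 'v \<Rightarrow> 'e list \<Rightarrow> 'v \<Rightarrow> bool" where
  "path_between D u [] w \<longleftrightarrow> u = w \<and> u \<in> verts D"
| "path_between D u (x # xs) w \<longleftrightarrow> x \<in> arcs D \<and> head D x = u \<and> path_between D (tail D x) xs w"

lemma path_between_verts:
  assumes "wf_digraph D" "path_between D u xs w"
  shows "u \<in> verts D" "w \<in> verts D"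
proof -
  interpret wf_digraph D by fact
  show "u \<in> verts D" using assms(2) by (cases xs) auto
  show "w \<in> verts D" using assms(2) by (induction xs arbitrary: u) auto
qed

lemma path_between_appendI:
  assumes "path_between D u xs t" "path_between D t ys w"
  shows "path_between D u (xs @ ys) w"
  using assms by (induction xs arbitrary: u) auto

lemma path_between_arcs: "path_between D u xs w \<Longrightarrow> set xs \<subseteq> arcs D"
  by (induction xs arbitrary: u) auto

lemma path_between_iff:
  assumes "wf_digraph D"
  shows "path_between D u xs w \<longleftrightarrow>
    (u, xs) \<in> Mor (path_category D) \<and> Src (path_category D) (u, xs) = w"
proof (induction xs arbitrary: u)
  case (Cons x xs)
  interpret wf_digraph D by fact
  show ?case
    unfolding path_between.simps Cons
    by (cases xs) (auto simp: path_category_def)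
qed (auto simp: path_category_def)

lemma Comp_path_category [simp]: "Comp (path_category D) (u, xs) (w, ys) = (u, xs @ ys)"
  by (simp add: path_category_def)

lemma Rng_path_category [simp]: "Rng (path_category D) p = fst p"
  by (simp add: path_category_def)

lemma Id_path_category [simp]: "Id (path_category D) u = (u, [])"
  by (simp add: path_category_def)

section \<open>Formal inverses of letters and of undirected paths\<close>

lemma flip_flip [simp]: "flip (flip x) = x"
  by (cases x) auto

lemma flip_in_signed_letters [simp]: "flip x \<in> signed_letters X \<longleftrightarrow> x \<in> signed_letters X"
  by (cases x) (auto simp: signed_letters_def)

lemma verts_double_graph [simp]: "verts (double_graph E) = verts E"
  by (simp add: double_graph_def)

lemma arcs_double_graph [simp]: "arcs (double_graph E) = signed_letters (arcs E)"
  by (simp add: double_graph_def)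

lemma tail_flip [simp]: "tail (double_graph E) (flip x) = head (double_graph E) x"
  and head_flip [simp]: "head (double_graph E) (flip x) = tail (double_graph E) x"
  by (cases x; simp add: double_graph_def)+

definition inverse_path :: "'e signed list \<Rightarrow> 'e signed list" where
  "inverse_path xs = rev (map flip xs)"

lemma inverse_path_simps [simp]:
  "inverse_path [] = []"
  "inverse_path (x # xs) = inverse_path xs @ [flip x]"
  "inverse_path (inverse_path xs) = xs"
  by (simp_all add: inverse_path_def rev_map o_def)

lemma set_inverse_path_subset:
  "set (inverse_path xs) \<subseteq> signed_letters X \<longleftrightarrow> set xs \<subseteq> signed_letters X"
  by (induction xs) auto

lemma path_between_inverse_path:
  assumes "wf_digraph E" "path_between (double_graph E) u xs w"
  shows "path_between (double_graph E) w (inverse_path xs) u"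
  using assms(2)
proof (induction xs arbitrary: u)
  case (Cons x xs)
  have "u \<in> verts E"
    using path_between_verts(1)[OF wf_double_graph[OF assms(1)] Cons.prems] by simp
  with Cons show ?case by (auto intro!: path_between_appendI)
qed simp

lemma path_between_subgraph:
  assumes "subgraph T E" "path_between (double_graph T) u xs w"
  shows "path_between (double_graph E) u xs w"
proof -
  have sub: "verts T \<subseteq> verts E" "arcs T \<subseteq> arcs E" "tail E = tail T" "head E = head T"
    using assms(1) by (auto simp: subgraph_def compatible_def)
  then have "tail (double_graph E) = tail (double_graph T)"
    "head (double_graph E) = head (double_graph T)"
    "signed_letters (arcs T) \<subseteq> signed_letters (arcs E)"
    by (auto simp: double_graph_def signed_letters_def)
  with sub assms(2) show ?thesis by (induction xs arbitrary: u) auto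
qed


section \<open>Presentation congruences\<close>

locale presentation =
  fixes X :: "'x set" and R :: "('x signed list \<times> 'x signed list) set"
  assumes words: "R \<subseteq> lists (signed_letters X) \<times> lists (signed_letters X)"
begin

abbreviation word_eq (infix \<open>\<sim>\<close> 50) where
  "a \<sim> b \<equiv> (a, b) \<in> presentation_congruence X R"

lemma word_congruence: "is_word_congruence X (presentation_congruence X R)"
  by (rule is_word_congruence_presentation[OF words])

lemma equiv_word_eq: "equiv (lists (signed_letters X)) (presentation_congruence X R)"
  using word_congruence by (simp add: is_word_congruence_def)

lemma word_eq_refl: "set a \<subseteq> signed_letters X \<Longrightarrow> a \<sim> a"
  using equiv_word_eq by (auto simp: equiv_def refl_on_def)

lemma word_eq_sym: "a \<sim> b \<Longrightarrow> b \<sim> a"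
  using equiv_word_eq by (auto simp: equiv_def dest: symD)

lemma word_eq_trans [trans]: "a \<sim> b \<Longrightarrow> b \<sim> c \<Longrightarrow> a \<sim> c"
  using equiv_word_eq by (auto simp: equiv_def dest: transD)

lemma word_eq_letters: "a \<sim> b \<Longrightarrow> set a \<subseteq> signed_letters X \<and> set b \<subseteq> signed_letters X"
  using equiv_word_eq by (auto simp: equiv_def)

lemma word_eq_append: "a \<sim> a' \<Longrightarrow> b \<sim> b' \<Longrightarrow> a @ b \<sim> a' @ b'"
  using word_congruence unfolding is_word_congruence_def by blast

lemma word_eq_cancel: "x \<in> signed_letters X \<Longrightarrow> [flip x, x] \<sim> []"
  using word_congruence unfolding is_word_congruence_def by blast

lemma relation_word_eq: "(a, b) \<in> R \<Longrightarrow> a \<sim> b"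
  unfolding presentation_congruence_def by blast

lemma presentation_congruence_least:
  "is_word_congruence X \<theta> \<Longrightarrow> R \<subseteq> \<theta> \<Longrightarrow> presentation_congruence X R \<subseteq> \<theta>"
  unfolding presentation_congruence_def by blast

text \<open>Inserting the trivial letter \<open>x\<close> behind \<open>flip x\<close> creates a
  cancelling pair.\<close>

lemma flip_trivial:
  assumes "[x] \<sim> []"
  shows "[flip x] \<sim> []"
proof -
  have x: "x \<in> signed_letters X" using word_eq_letters[OF assms] by simp
  have "[flip x] @ [] \<sim> [flip x] @ [x]"
    by (intro word_eq_append word_eq_refl word_eq_sym[OF assms]) (simp add: x)
  also have "[flip x] @ [x] \<sim> []" using word_eq_cancel[OF x] by simp
  finally show ?thesis by simp
qed

lemma trivial_letters_trivial:
  assumes "\<And>t. t \<in> Y \<Longrightarrow> [Pos t] \<sim> []" "set a \<subseteq> signed_letters Y"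
  shows "a \<sim> []"
  using assms(2)
proof (induction a)
  case (Cons x a)
  then have "[x] \<sim> []"
    using assms(1) flip_trivial[of "Pos _"] by (auto simp: signed_letters_def)
  then have "[x] @ a \<sim> [] @ []" using Cons by (intro word_eq_append) auto
  then show ?case by simp
qed (rule word_eq_refl, simp)

lemma carrier_presented_group:
  "carrier (presented_group X R) =
    (\<lambda>a. presentation_congruence X R `` {a}) ` {a. set a \<subseteq> signed_letters X}"
  by (auto simp: presented_group_def Let_def quotient_def)

lemma mult_presented_group:
  assumes "set a \<subseteq> signed_letters X" "set b \<subseteq> signed_letters X"
  shows "presentation_congruence X R `` {a} \<otimes>\<^bsub>presented_group X R\<^esub> presentation_congruence X R `` {b}
    = presentation_congruence X R `` {a @ b}"
proof -
  have "presentation_congruence X R `` {x @ y} = presentation_congruence X R `` {a @ b}"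
    if "a \<sim> x" "b \<sim> y" for x y
    using equiv_class_eq[OF equiv_word_eq word_eq_append[OF that]] by simp
  then have "(\<Union>x\<in>presentation_congruence X R `` {a}. \<Union>y\<in>presentation_congruence X R `` {b}.
      presentation_congruence X R `` {x @ y}) =
    (\<Union>x\<in>presentation_congruence X R `` {a}. \<Union>y\<in>presentation_congruence X R `` {b}.
      presentation_congruence X R `` {a @ b})"
    by (intro SUP_cong refl) auto
  moreover have "presentation_congruence X R `` {a} \<noteq> {}" "presentation_congruence X R `` {b} \<noteq> {}"
    using assms word_eq_refl by blast+
  ultimately show ?thesis by (simp add: presented_group_def Let_def)
qed

end

text \<open>Each generated congruence is minimal, hence contained in the other. This later trades
  the square relations of all lengths for those of length two.\<close>

lemma presentation_congruence_eqI:
  assumes "presentation X A" "presentation X B"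
    and "A \<subseteq> presentation_congruence X B" "B \<subseteq> presentation_congruence X A"
  shows "presentation_congruence X A = presentation_congruence X B"
proof -
  interpret A: presentation X A by fact
  interpret B: presentation X B by fact
  show ?thesis
    using A.presentation_congruence_least[OF B.word_congruence assms(3)]
      B.presentation_congruence_least[OF A.word_congruence assms(4)] by blast
qed


section \<open>The isotropy group of a quotient of the undirected path category\<close>

text \<open>Nothing here refers to k-graphs: \<open>S\<close> is any set of pairs of undirected
  paths with common endpoints, so the isomorphism is proved for a general graph with a spanning
  tree.\<close>

locale groupoid_relations =
  fixes E T :: "('v, 'e) pre_digraph" and v :: 'v
    and S :: "(('v \<times> 'e signed list) \<times> ('v \<times> 'e signed list)) set"
  assumes tree: "maximal_spanning_tree T E"
    and base: "v \<in> verts E"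
    and parallel: "(p, q) \<in> S \<Longrightarrow>
      p \<in> Mor (undirected_paths E) \<and> q \<in> Mor (undirected_paths E) \<and>
      Rng (undirected_paths E) p = Rng (undirected_paths E) q \<and>
      Src (undirected_paths E) p = Src (undirected_paths E) q"
begin

definition \<theta> :: "(('v \<times> 'e signed list) \<times> ('v \<times> 'e signed list)) set" where
  "\<theta> = generated_congruence (undirected_paths E) (cancellation_relations E \<union> S)"

text \<open>Pairs of paths of every length are kept here; the shorter list of relations in the final
  statement is compared with this one at the end.\<close>

definition relation_words :: "('e signed list \<times> 'e signed list) set" where
  "relation_words = tree_relations T \<union> map_prod snd snd ` S"

abbreviation upath where "upath \<equiv> path_between (double_graph E)"

abbreviation tpath where "tpath \<equiv> path_between (double_graph T)"

lemma subgraph_T: "subgraph T E" and verts_T: "verts T = verts E"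
  using tree by (simp_all add: maximal_spanning_tree_def)

lemma wf_E: "wf_digraph E" and wf_T: "wf_digraph T"
  using subgraph_T by (auto simp: subgraph_def)

lemmas wf_DE = wf_double_graph[OF wf_E]
lemmas wf_DT = wf_double_graph[OF wf_T]

sublocale category "undirected_paths E"
  by (rule category_path_category[OF wf_DE])

lemmas upath_iff = path_between_iff[OF wf_DE]

lemma relations_parallel':
  assumes "(p, q) \<in> cancellation_relations E \<union> S"
  shows "p \<in> Mor (undirected_paths E) \<and> q \<in> Mor (undirected_paths E) \<and>
      Rng (undirected_paths E) p = Rng (undirected_paths E) q \<and>
      Src (undirected_paths E) p = Src (undirected_paths E) q"
proof (cases "(p, q) \<in> S")
  case False
  then obtain x where x: "x \<in> signed_letters (arcs E)"
    "p = (tail (double_graph E) x, [flip x, x])" "q = (tail (double_graph E) x, [])"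
    using assms by (auto simp: cancellation_relations_def)
  then have "tail (double_graph E) x \<in> verts E"
    using wf_digraph.tail_in_verts[OF wf_DE, of x] by simp
  with x have "upath (fst p) (snd p) (tail (double_graph E) x)"
    "upath (fst q) (snd q) (tail (double_graph E) x)" by auto
  then show ?thesis unfolding upath_iff using x by simp
qed (rule parallel)

lemma congruence_\<theta>: "is_congruence (undirected_paths E) \<theta>"
  and relations_\<theta>: "cancellation_relations E \<union> S \<subseteq> \<theta>"
  unfolding \<theta>_def
  using is_congruence_generated[OF category_axioms, of "cancellation_relations E \<union> S"]
    relations_parallel' by blast+

sublocale category_congruence "undirected_paths E" \<theta>
  by unfold_locales (rule congruence_\<theta>)

section \<open>Calculating with congruent undirected paths\<close>

abbreviation path_eq where "path_eq u xs ys \<equiv> ((u, xs), (u, ys)) \<in> \<theta>"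

lemma path_eq_refl: "upath u xs w \<Longrightarrow> path_eq u xs xs"
  by (auto simp: upath_iff intro: cong_refl)

lemma path_eq_sym: "path_eq u xs ys \<Longrightarrow> path_eq u ys xs"
  using equiv_cong by (auto simp: equiv_def dest: symD)

lemma path_eq_trans [trans]: "path_eq u xs ys \<Longrightarrow> path_eq u ys zs \<Longrightarrow> path_eq u xs zs"
  using equiv_cong by (auto simp: equiv_def dest: transD)

lemma path_eq_append:
  assumes "path_eq u xs xs'" "path_eq w ys ys'" "upath u xs w"
  shows "path_eq u (xs @ ys) (xs' @ ys')"
  using cong_Comp[OF assms(1,2)] assms(3) by (simp add: upath_iff)

lemma path_eq_cancel:
  assumes "x \<in> signed_letters (arcs E)"
  shows "path_eq (head (double_graph E) x) [x, flip x] []"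
proof -
  \<comment> \<open>The defining relations put the flipped letter first, so the instance taken is
    the one for \<open>flip x\<close>.\<close>
  have "((tail (double_graph E) (flip x), [flip (flip x), flip x]), (tail (double_graph E) (flip x), []))
      \<in> cancellation_relations E"
    using assms unfolding cancellation_relations_def by (intro CollectI exI[of _ "flip x"]) simp
  then show ?thesis using relations_\<theta> by auto
qed

lemma path_eq_remove_middle:
  assumes "upath u xs t" "path_eq t ms []" "upath t ys w"
  shows "path_eq u (xs @ ms @ ys) (xs @ ys)"
proof -
  \<comment> \<open>Congruent paths have the same endpoints, and the empty path at \<open>t\<close>
    is closed, so \<open>ms\<close> is closed at \<open>t\<close> as well.\<close>
  have "upath t ms t"
    using cong_par[OF assms(2)] assms(2) equiv_cong path_between_verts(1)[OF wf_DE assms(3)]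
    by (auto simp: upath_iff equiv_def path_category_def)
  then have "path_eq t (ms @ ys) ([] @ ys)"
    using assms by (intro path_eq_append path_eq_refl)
  then show ?thesis using assms(1) by (intro path_eq_append path_eq_refl) auto
qed

text \<open>The first letter and its inverse enclose the product for the remaining path; that
  product is removed by induction, and the two outer letters then cancel.\<close>

lemma path_eq_inverse:
  assumes "upath u xs w"
  shows "path_eq u (xs @ inverse_path xs) []"
  using assms
proof (induction xs arbitrary: u)
  case Nil
  then show ?case using path_eq_refl[OF Nil] by simp
next
  case (Cons x xs)
  let ?t = "tail (double_graph E) x"
  have x: "x \<in> signed_letters (arcs E)" "u = head (double_graph E) x" "upath ?t xs w"
    using Cons.prems by auto
  then have *: "upath u [x] ?t" "upath ?t [flip x] u"
    using path_between_verts(1)[OF wf_DE Cons.prems] path_between_verts(1)[OF wf_DE x(3)] by auto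
  have "path_eq u ([x] @ (xs @ inverse_path xs) @ [flip x]) ([x] @ [flip x])"
    using Cons.IH[OF x(3)] * by (intro path_eq_remove_middle)
  also have "path_eq u ([x] @ [flip x]) []"
    using path_eq_cancel[OF x(1)] x(2) by simp
  finally show ?case by simp
qed

lemma path_eq_inverse':
  assumes "upath u xs w"
  shows "path_eq w (inverse_path xs @ xs) []"
  using path_eq_inverse[OF path_between_inverse_path[OF wf_E assms]] by simp


subsection \<open>Paths in the tree\<close>

lemma tpath_upath: "tpath u xs w \<Longrightarrow> upath u xs w"
  by (rule path_between_subgraph[OF subgraph_T])

text \<open>Letters are put in front of an already reduced path one at a time. A new letter either
  cancels against the first letter, which leaves a reduced tail, or extends the path to a reduced
  one. All reductions stay inside the tree.\<close>

lemma tpath_reduce: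
  assumes "tpath u xs w"
  shows "\<exists>ys. tpath u ys w \<and> reduced (u, ys) \<and> path_eq u xs ys"
  using assms
proof (induction xs arbitrary: u)
  case Nil
  then show ?case
    using path_eq_refl[OF tpath_upath[OF Nil]] by (intro exI[of _ "[]"]) (auto simp: reduced_def)
next
  case (Cons x xs)
  let ?t = "tail (double_graph T) x"
  have x: "x \<in> arcs (double_graph T)" "head (double_graph T) x = u" "tpath ?t xs w"
    using Cons.prems by auto
  then obtain ys where ys: "tpath ?t ys w" "reduced (?t, ys)" "path_eq ?t xs ys"
    using Cons.IH by blast
  have tx: "tpath u [x] ?t"
    using x path_between_verts(1)[OF wf_DT x(3)] by simp
  then have eq: "path_eq u ([x] @ xs) ([x] @ ys)"
    by (intro path_eq_append[OF path_eq_refl ys(3)] tpath_upath)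
  show ?case
  proof (cases "\<exists>zs. ys = flip x # zs")
    case True
    then obtain zs where zs: "ys = flip x # zs" by blast
    have z: "tpath u zs w" using ys(1) zs x(2) by simp
    have xu: "x \<in> signed_letters (arcs E)" "head (double_graph E) x = u"
      using tpath_upath[OF Cons.prems] by simp_all
    have u: "upath u [] u"
      using path_between_verts(1)[OF wf_DE tpath_upath[OF z]] by simp
    have "path_eq u ([] @ [x, flip x] @ zs) ([] @ zs)"
      using path_eq_cancel[OF xu(1)] xu(2) u tpath_upath[OF z]
      by (intro path_eq_remove_middle) auto
    with eq zs have "path_eq u (x # xs) zs" using path_eq_trans by simp
    moreover have "reduced (u, zs)"
      using ys(2) zs by (cases zs) (auto simp: reduced_def)
    ultimately show ?thesis using z by blast
  next
    case False
    then have "reduced (u, x # ys)"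
      using ys(2) by (cases ys) (auto simp: reduced_def)
    then show ?thesis using eq x ys by (intro exI[of _ "x # ys"]) auto
  qed
qed

text \<open>Here the absence of nontrivial reduced closed paths in the tree enters: the reduced form
  of a closed tree path must be a vertex.\<close>

lemma closed_tpath_trivial:
  assumes "tpath u xs u"
  shows "path_eq u xs []"
proof -
  obtain ys where ys: "tpath u ys u" "reduced (u, ys)" "path_eq u xs ys"
    using tpath_reduce[OF assms] by blast
  then have "(u, ys) \<in> Id (undirected_paths T) ` verts T"
    using tree path_between_iff[OF wf_DT]
    unfolding maximal_spanning_tree_def undirected_tree_def by force
  with ys(3) show ?thesis by auto
qed

text \<open>Fixing the empty branch at \<open>v\<close> makes the outer branches of a closed path at
  \<open>v\<close> vanish, so that no conjugation is left over for such paths.\<close>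

definition branch :: "'v \<Rightarrow> 'e signed list" where
  "branch u = (if u = v then [] else SOME xs. tpath v xs u)"

lemma branch_base [simp]: "branch v = []"
  by (simp add: branch_def)

lemma tpath_branch:
  assumes "u \<in> verts E"
  shows "tpath v (branch u) u"
proof (cases "u = v")
  case False
  have "connected_graph T"
    using tree by (simp add: maximal_spanning_tree_def undirected_tree_def)
  then obtain p where "p \<in> Mor (undirected_paths T)" "Rng (undirected_paths T) p = v"
    "Src (undirected_paths T) p = u"
    using assms base verts_T unfolding connected_graph_def by blast
  then have "tpath v (snd p) u"
    using path_between_iff[OF wf_DT] by (cases p) auto
  then show ?thesis using False by (auto simp: branch_def intro: someI)
qed (use base verts_T in simp)

lemmas upath_branch = tpath_upath[OF tpath_branch]
lemmas upath_inverse_branch = path_between_inverse_path[OF wf_E upath_branch]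


subsection \<open>From words to closed paths\<close>

text \<open>Letters of both signs are treated alike: \<open>loop (flip x)\<close> is
  \<open>inverse_path (loop x)\<close>.\<close>

definition loop :: "'e signed \<Rightarrow> 'e signed list" where
  "loop x = branch (head (double_graph E) x) @ [x] @ inverse_path (branch (tail (double_graph E) x))"

abbreviation loops :: "'e signed list \<Rightarrow> 'e signed list" where
  "loops xs \<equiv> concat (map loop xs)"

text \<open>Each \<open>loop x\<close> is closed at \<open>v\<close>, so even a word whose
  consecutive letters do not compose in the graph becomes a path.\<close>

lemma upath_loops:
  assumes "set xs \<subseteq> signed_letters (arcs E)"
  shows "upath v (loops xs) v"
  using assms
proof (induction xs)
  case (Cons x xs)
  have V: "head (double_graph E) x \<in> verts E" "tail (double_graph E) x \<in> verts E"
    using Cons.prems wf_digraph.wellformed[OF wf_DE, of x] by auto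
  have "upath (head (double_graph E) x) [x] (tail (double_graph E) x)"
    using Cons.prems V by simp
  then have "upath v (loop x) v"
    unfolding loop_def
    by (intro path_between_appendI[OF upath_branch[OF V(1)]]
        path_between_appendI[OF _ upath_inverse_branch[OF V(2)]])
  then show ?case using Cons by (auto intro: path_between_appendI)
qed (use base in simp)

text \<open>The product telescopes. The source of a letter is the range of the next one, so the
  branch leading back to \<open>v\<close> is followed at once by the same branch leading out
  again.\<close>

lemma loops_upath:
  assumes "upath u xs w"
  shows "path_eq v (loops xs) (branch u @ xs @ inverse_path (branch w))"
  using assms
proof (induction xs arbitrary: u)
  case Nil
  then show ?case using path_eq_sym[OF path_eq_inverse[OF upath_branch]] by auto
next
  case (Cons x xs)
  let ?t = "tail (double_graph E) x"
  have x: "x \<in> signed_letters (arcs E)" "head (double_graph E) x = u" "upath ?t xs w"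
    using Cons.prems by auto
  have V: "u \<in> verts E" "?t \<in> verts E" "w \<in> verts E"
    using path_between_verts[OF wf_DE Cons.prems] path_between_verts[OF wf_DE x(3)] by auto
  have loop: "upath v (loop x) v" using upath_loops[of "[x]"] x(1) by simp
  have 1: "upath v (branch u @ [x]) ?t" using V x by (auto intro!: path_between_appendI upath_branch)
  have 2: "upath ?t (xs @ inverse_path (branch w)) v"
    by (intro path_between_appendI[OF x(3)] upath_inverse_branch V)
  \<comment> \<open>The regrouping exposes the pair of opposite branches at \<open>?t\<close> that
    is to be removed.\<close>
  have loop_branch: "loop x @ branch ?t @ xs @ inverse_path (branch w) =
    (branch u @ [x]) @ (inverse_path (branch ?t) @ branch ?t) @ xs @ inverse_path (branch w)"
    by (simp add: loop_def x(2))
  have "path_eq v (loop x @ loops xs) (loop x @ branch ?t @ xs @ inverse_path (branch w))"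
    using loop Cons.IH[OF x(3)] by (intro path_eq_append path_eq_refl) auto
  also have "path_eq v (loop x @ branch ?t @ xs @ inverse_path (branch w)) ((branch u @ [x]) @ xs @ inverse_path (branch w))"
    unfolding loop_branch
    using path_eq_remove_middle[OF 1 path_eq_inverse'[OF upath_branch[OF V(2)]] 2] .
  finally show ?case by simp
qed

lemma loops_closed_upath:
  assumes "upath v xs v"
  shows "path_eq v (loops xs) xs"
  using loops_upath[OF assms] by simp

text \<open>Both branches and the edge itself lie in the tree, so the loop is a closed tree path and
  \<open>closed_tpath_trivial\<close> applies.\<close>

lemma loops_tree_arc:
  assumes "t \<in> arcs T"
  shows "path_eq v (loops [Pos t]) []"
proof -
  \<comment> \<open>A subgraph has the same endpoint maps, so \<open>loop\<close>, defined with
    those of \<open>E\<close>, can be followed in \<open>T\<close>.\<close>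
  have eq: "tail (double_graph E) = tail (double_graph T)" "head (double_graph E) = head (double_graph T)"
    using compatible_tail[of E T] compatible_head[of E T] subgraph_T
    by (simp_all only: subgraph_def double_graph_def pre_digraph.simps)
  have t: "Pos t \<in> arcs (double_graph T)" using assms by (simp add: signed_letters_def)
  then have V: "head (double_graph T) (Pos t) \<in> verts E" "tail (double_graph T) (Pos t) \<in> verts E"
    using wf_digraph.wellformed[OF wf_DT t] verts_T by auto
  have "tpath v (loop (Pos t)) v"
    unfolding loop_def eq
    by (intro path_between_appendI[OF tpath_branch[OF V(1)]]
        path_between_appendI[OF _ path_between_inverse_path[OF wf_T tpath_branch[OF V(2)]]])
      (use t V verts_T in auto)
  then show ?thesis using closed_tpath_trivial by simp
qed

text \<open>This is the path congruence pulled back along \<open>loops\<close>. Once it is seen to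
  be a word congruence containing the relations, minimality shows that \<open>loops\<close> respects
  the presentation congruence.\<close>

definition loop_congruence :: "('e signed list \<times> 'e signed list) set" where
  "loop_congruence = {(a, b). set a \<subseteq> signed_letters (arcs E) \<and> set b \<subseteq> signed_letters (arcs E) \<and>
     path_eq v (loops a) (loops b)}"

text \<open>Congruent paths share both endpoints, so \<open>loops_upath\<close> conjugates them by
  the same two branches.\<close>

lemma loop_congruence_parallel:
  assumes "((u, a), (u', b)) \<in> \<theta>"
  shows "(a, b) \<in> loop_congruence"
proof -
  have u: "u' = u" using cong_par[OF assms] by simp
  obtain w where w: "upath u a w" "upath u b w"
    using assms cong_par[OF assms] equiv_cong by (auto simp: upath_iff equiv_def)
  then have V: "u \<in> verts E" "w \<in> verts E" using path_between_verts[OF wf_DE] by auto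
  have "path_eq v (loops a) (branch u @ a @ inverse_path (branch w))" by (rule loops_upath[OF w(1)])
  also have "path_eq v (branch u @ a @ inverse_path (branch w)) (branch u @ b @ inverse_path (branch w))"
    using assms path_eq_append[OF path_eq_refl[OF upath_branch[OF V(1)]] _ upath_branch[OF V(1)]]
      path_eq_append[OF _ path_eq_refl[OF upath_inverse_branch[OF V(2)]] w(1)] u by simp
  also have "path_eq v (branch u @ b @ inverse_path (branch w)) (loops b)" by (rule path_eq_sym[OF loops_upath[OF w(2)]])
  finally show ?thesis
    using path_between_arcs[OF w(1)] path_between_arcs[OF w(2)] by (simp add: loop_congruence_def)
qed

lemma is_word_congruence_loop: "is_word_congruence (arcs E) loop_congruence"
  unfolding is_word_congruence_def
proof (intro conjI)
  show "equiv (lists (signed_letters (arcs E))) loop_congruence"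
  proof (rule equivI)
    show "refl_on (lists (signed_letters (arcs E))) loop_congruence"
      using path_eq_refl[OF upath_loops] by (auto simp: refl_on_def loop_congruence_def)
  qed (auto simp: loop_congruence_def sym_def trans_def intro: path_eq_sym path_eq_trans)
  show "\<forall>(a, a')\<in>loop_congruence. \<forall>(b, b')\<in>loop_congruence. (a @ b, a' @ b') \<in> loop_congruence"
    using upath_loops by (auto simp: loop_congruence_def intro!: path_eq_append)
  \<comment> \<open>The word \<open>[flip x, x]\<close> is itself a path congruent to an empty path,
    so it falls under \<open>loop_congruence_parallel\<close>.\<close>
  show "\<forall>x\<in>signed_letters (arcs E). ([flip x, x], []) \<in> loop_congruence"
    using path_eq_cancel[of "flip _"] by (auto intro: loop_congruence_parallel)
qed

lemma relation_words_loop: "relation_words \<subseteq> loop_congruence"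
proof -
  have "([Pos t], []) \<in> loop_congruence" if "t \<in> arcs T" for t
    using loops_tree_arc[OF that] that subgraph_T
    by (auto simp: loop_congruence_def signed_letters_def subgraph_def)
  moreover have "(snd p, snd q) \<in> loop_congruence" if "(p, q) \<in> S" for p q
    using that relations_\<theta> by (cases p, cases q) (auto intro: loop_congruence_parallel)
  ultimately show ?thesis by (auto simp: relation_words_def tree_relations_def)
qed


subsection \<open>The isomorphism\<close>

sublocale presentation "arcs E" relation_words
proof
  have "relation_words \<subseteq> loop_congruence" by (rule relation_words_loop)
  also have "\<dots> \<subseteq> lists (signed_letters (arcs E)) \<times> lists (signed_letters (arcs E))"
    by (auto simp: loop_congruence_def)
  finally show "relation_words \<subseteq> \<dots>" .
qed

notation word_eq (infix \<open>\<sim>\<close> 50)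

text \<open>This will give injectivity. Congruent words have congruent images under
  \<open>loops\<close>, and on closed paths at \<open>v\<close> the map \<open>loops\<close> is the
  identity modulo \<open>\<theta>\<close>.\<close>

lemma word_eq_path_eq:
  assumes "a \<sim> b" "upath v a v" "upath v b v"
  shows "path_eq v a b"
proof -
  have "path_eq v (loops a) (loops b)"
    using presentation_congruence_least[OF is_word_congruence_loop relation_words_loop] assms(1)
    by (auto simp: loop_congruence_def)
  then show ?thesis
    using loops_closed_upath[OF assms(2)] loops_closed_upath[OF assms(3)]
    by (meson path_eq_sym path_eq_trans)
qed

text \<open>This makes reading off words well defined on classes. Parallel paths with congruent
  words form a category congruence that contains the generators of \<open>\<theta>\<close>, hence
  all of \<open>\<theta>\<close>.\<close>

lemma path_eq_word_eq:
  assumes "(p, q) \<in> \<theta>"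
  shows "snd p \<sim> snd q"
proof -
  let ?C = "undirected_paths E"
  let ?K = "{(p, q). p \<in> Mor ?C \<and> q \<in> Mor ?C \<and> Rng ?C p = Rng ?C q \<and> Src ?C p = Src ?C q \<and>
    snd p \<sim> snd q}"
  have letters: "set (snd p) \<subseteq> signed_letters (arcs E)" if "p \<in> Mor ?C" for p
    using that by (auto simp: path_category_def)
  have snd_Comp: "snd (Comp ?C p q) = snd p @ snd q" for p q by (cases p; cases q) simp
  have "is_congruence ?C ?K"
    unfolding is_congruence_def
  proof (intro conjI)
    show "equiv (Mor ?C) ?K"
    proof (rule equivI)
      show "refl_on (Mor ?C) ?K" using letters by (auto simp: refl_on_def intro: word_eq_refl)
    qed (auto simp: sym_def trans_def intro: word_eq_sym word_eq_trans)
    show "\<forall>(a, a')\<in>?K. \<forall>(b, b')\<in>?K. Src ?C a = Rng ?C b \<longrightarrow> (Comp ?C a b, Comp ?C a' b') \<in> ?K"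
      unfolding snd_Comp[symmetric]
      by (clarsimp simp: Comp_in Src_Comp Rng_Comp[unfolded Rng_path_category] snd_Comp word_eq_append)
  qed auto
  moreover have "cancellation_relations E \<union> S \<subseteq> ?K"
  proof (rule subrelI)
    fix p q assume pq: "(p, q) \<in> cancellation_relations E \<union> S"
    have "snd p \<sim> snd q"
    proof (cases "(p, q) \<in> S")
      case True
      then have "(snd p, snd q) \<in> relation_words" by (force simp: relation_words_def)
      then show ?thesis by (rule relation_word_eq)
    next
      case False
      then show ?thesis
        using pq word_eq_cancel by (auto simp: cancellation_relations_def)
    qed
    with relations_parallel'[OF pq] show "(p, q) \<in> ?K" by simp
  qed
  ultimately have "\<theta> \<subseteq> ?K" unfolding \<theta>_def generated_congruence_def by blast
  with assms show ?thesis by blast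
qed

text \<open>This will give surjectivity: the closed path \<open>loops a\<close> reads off the
  element of the presented group that \<open>a\<close> represents.\<close>

lemma loops_word_eq:
  assumes "set a \<subseteq> signed_letters (arcs E)"
  shows "loops a \<sim> a"
  using assms
proof (induction a)
  case (Cons x a)
  \<comment> \<open>Branches run inside the tree, so all their letters, of either sign, are killed
    by the tree relations.\<close>
  have branch: "branch u \<sim> []" "inverse_path (branch u) \<sim> []" if "u \<in> verts E" for u
  proof -
    have "set (branch u) \<subseteq> signed_letters (arcs T)"
      using path_between_arcs[OF tpath_branch[OF that]] by simp
    moreover have "[Pos t] \<sim> []" if "t \<in> arcs T" for t
      using that by (intro relation_word_eq) (auto simp: relation_words_def tree_relations_def)
    ultimately show "branch u \<sim> []" "inverse_path (branch u) \<sim> []"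
      using trivial_letters_trivial[of "arcs T"] by (simp_all add: set_inverse_path_subset)
  qed
  have V: "head (double_graph E) x \<in> verts E" "tail (double_graph E) x \<in> verts E"
    using Cons.prems wf_digraph.wellformed[OF wf_DE, of x] by auto
  have "[x] \<sim> [x]" "loops a \<sim> a" using Cons by (auto intro: word_eq_refl)
  then have "loop x @ loops a \<sim> ([] @ [x] @ []) @ a"
    unfolding loop_def
    by (rule word_eq_append[OF word_eq_append[OF branch(1)[OF V(1)]
          word_eq_append[OF _ branch(2)[OF V(2)]]]])
  then show ?case by simp
qed (simp add: word_eq_refl)

theorem isotropy_group_iso_presented_group:
  "isotropy_group (quotient_category (undirected_paths E) \<theta>) v \<cong> presented_group (arcs E) relation_words"
proof -
  let ?G = "isotropy_group Q v" and ?H = "presented_group (arcs E) relation_words"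
  let ?\<kappa> = "presentation_congruence (arcs E) relation_words"
  \<comment> \<open>The union avoids choosing a representative: on a class of paths all its members
    coincide.\<close>
  define h where "h A = (\<Union>p\<in>A. ?\<kappa> `` {snd p})" for A :: "('v \<times> 'e signed list) set"
  have h: "h (\<theta> `` {p}) = ?\<kappa> `` {snd p}" if "p \<in> Mor (undirected_paths E)" for p
  proof -
    have "?\<kappa> `` {snd q} = ?\<kappa> `` {snd p}" if "(p, q) \<in> \<theta>" for q
      using equiv_class_eq[OF equiv_word_eq path_eq_word_eq[OF that]] by simp
    then show ?thesis using cong_refl[OF that] unfolding h_def by blast
  qed
  have carrier_G: "carrier ?G = (\<lambda>xs. \<theta> `` {(v, xs)}) ` {xs. upath v xs v}"
    by (auto simp: isotropy_group_def Mor_Q Src_Q Rng_Q upath_iff image_iff)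
  have h': "h (\<theta> `` {(v, xs)}) = ?\<kappa> `` {xs}" if "upath v xs v" for xs
    using h[of "(v, xs)"] that by (simp add: upath_iff)
  have letters: "set xs \<subseteq> signed_letters (arcs E)" if "upath v xs v" for xs
    using path_between_arcs[OF that] by simp
  have mult_G: "\<theta> `` {(v, xs)} \<otimes>\<^bsub>?G\<^esub> \<theta> `` {(v, ys)} = \<theta> `` {(v, xs @ ys)}"
    if "upath v xs v" "upath v ys v" for xs ys
    using that Comp_Q[of "(v, xs)" "(v, ys)"] by (simp add: isotropy_group_def upath_iff)
  have "h \<in> hom ?G ?H"
  proof (rule homI)
    fix A assume "A \<in> carrier ?G"
    then show "h A \<in> carrier ?H"
      using letters unfolding carrier_G carrier_presented_group by (auto simp: h')
  next
    fix A B assume "A \<in> carrier ?G" "B \<in> carrier ?G"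
    then show "h (A \<otimes>\<^bsub>?G\<^esub> B) = h A \<otimes>\<^bsub>?H\<^esub> h B"
      unfolding carrier_G
      by (auto simp: mult_G h' mult_presented_group letters path_between_appendI)
  qed
  moreover have "inj_on h (carrier ?G)"
  proof (rule inj_onI)
    fix A B assume "A \<in> carrier ?G" "B \<in> carrier ?G" and eq: "h A = h B"
    then obtain xs ys where xs: "A = \<theta> `` {(v, xs)}" "upath v xs v"
      and ys: "B = \<theta> `` {(v, ys)}" "upath v ys v" unfolding carrier_G by blast
    with eq have "xs \<sim> ys"
      using eq_equiv_class[OF _ equiv_word_eq, of xs ys] letters by (auto simp: h')
    then show "A = B"
      using equiv_class_eq[OF equiv_cong word_eq_path_eq] xs ys by simp
  qed
  moreover have "carrier ?H \<subseteq> h ` carrier ?G"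
  proof
    fix B assume "B \<in> carrier ?H"
    then obtain a where a: "B = ?\<kappa> `` {a}" "set a \<subseteq> signed_letters (arcs E)"
      unfolding carrier_presented_group by blast
    \<comment> \<open>The class of \<open>loops a\<close> is the preimage, by
      \<open>loops_word_eq\<close>.\<close>
    then have "h (\<theta> `` {(v, loops a)}) = B"
      using h' upath_loops equiv_class_eq[OF equiv_word_eq loops_word_eq] by simp
    then show "B \<in> h ` carrier ?G"
      using upath_loops[OF a(2)] unfolding carrier_G by blast
  qed
  ultimately have "h \<in> iso ?G ?H"
    by (auto simp: iso_def bij_betw_def hom_def)
  then show ?thesis by (rule is_isoI)
qed

end


section \<open>The fundamental group of a k-graph\<close>

text \<open>Every elementary step changes only a two-edge subword, where a relation of length two
  applies; the unchanged context is restored by concatenation. Induction along a chain of steps does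
  the rest.\<close>

lemma square_equivalence_word_eq:
  assumes "k_graph \<Lambda> d"
    and "presentation (arcs (skeleton \<Lambda> d)) R" and R: "square_words \<Lambda> d \<subseteq> R"
    and "(p, q) \<in> square_equivalence \<Lambda> d"
  shows "(map Pos (snd p), map Pos (snd q)) \<in> presentation_congruence (arcs (skeleton \<Lambda> d)) R"
proof -
  interpret k_graph \<Lambda> d by fact
  interpret presentation "arcs (skeleton \<Lambda> d)" R by fact
  let ?P = "path_category (skeleton \<Lambda> d)"
  have letters: "set (map Pos (snd p)) \<subseteq> signed_letters (arcs (skeleton \<Lambda> d))" if "p \<in> Mor ?P" for p
    using that unfolding path_category_def signed_letters_def by fastforce
  have steps: "word_eq (map Pos (snd p)) (map Pos (snd q))" if pq: "square_step \<Lambda> d p q" for p q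
  proof -
    obtain u xs ys a b where ab: "(a, b) \<in> commuting_squares \<Lambda> d"
      "p = (u, xs @ a @ ys)" "q = (u, xs @ b @ ys)" "p \<in> Mor ?P" "q \<in> Mor ?P"
      using pq unfolding square_step_def by blast
    obtain f g g' f' where sq: "a = [f, g]" "b = [g', f']"
      using ab(1) by (auto simp: commuting_squares_def)
    \<comment> \<open>A pair in \<open>square_relations\<close> needs a range vertex. Both sides of
      the square compose to the same morphism, so its range serves for both.\<close>
    define w where "w = Rng \<Lambda> f"
    have "Rng \<Lambda> f = Rng \<Lambda> g'"
      using ab(1) Rng_Comp unfolding commuting_squares_def sq morphisms_of_degree_def by clarsimp metis
    then have "(w, a) \<in> Mor ?P" "(w, b) \<in> Mor ?P"
      using ab(1) Rng_in unfolding commuting_squares_def sq w_def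
      by (auto simp: path_category_def skeleton_def morphisms_of_degree_def)
    \<comment> \<open>The square alone is a step with empty context on both sides.\<close>
    moreover from this have "square_step \<Lambda> d (w, a) (w, b)"
      using ab(1) append_Nil append_Nil2 unfolding square_step_def by metis
    ultimately have "((w, a), (w, b)) \<in> square_equivalence \<Lambda> d"
      unfolding square_equivalence_def by (auto intro: r_into_equivclp)
    then have "((w, map Pos a), (w, map Pos b)) \<in> square_relations \<Lambda> d"
      unfolding square_relations_def by blast
    then have "(map Pos a, map Pos b) \<in> square_words \<Lambda> d"
      unfolding square_words_def sq by auto
    then have "word_eq (map Pos a) (map Pos b)" using R relation_word_eq by blast
    then have "word_eq (map Pos xs @ map Pos a @ map Pos ys) (map Pos xs @ map Pos b @ map Pos ys)"
      using letters[OF ab(4)] ab(2) by (intro word_eq_append word_eq_refl) auto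
    then show ?thesis using ab(2,3) by simp
  qed
  have "equivclp (square_step \<Lambda> d) p q" and p: "p \<in> Mor ?P"
    using assms(4) by (auto simp: square_equivalence_def)
  from this(1) show ?thesis
  proof (induction rule: equivclp_induct)
    case base
    show ?case by (rule word_eq_refl[OF letters[OF p]])
  next
    case (step q r)
    \<comment> \<open>The closure is symmetric, so a link may be a step in either direction.\<close>
    then show ?case using word_eq_trans steps word_eq_sym[OF steps] by blast
  qed
qed

text \<open>The pairs of inverse edges already have length two and belong to
  \<open>square_words\<close>; only the positive pairs need the chain argument.\<close>

lemma square_relations_word_eq:
  assumes "k_graph \<Lambda> d"
    and "presentation (arcs (skeleton \<Lambda> d)) R" and R: "square_words \<Lambda> d \<subseteq> R"
    and "(p, q) \<in> square_relations \<Lambda> d"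
  shows "(snd p, snd q) \<in> presentation_congruence (arcs (skeleton \<Lambda> d)) R"
proof -
  interpret presentation "arcs (skeleton \<Lambda> d)" R by fact
  from assms(4) consider
      (pos) u es w fs where "p = (u, map Pos es)" "q = (w, map Pos fs)"
        "((u, es), (w, fs)) \<in> square_equivalence \<Lambda> d"
    | (neg) e f g h where "p = (Src \<Lambda> f, [Neg f, Neg e])" "q = (Src \<Lambda> h, [Neg h, Neg g])"
    unfolding square_relations_def by (elim UnE CollectE exE conjE Pair_inject) metis+
  then show ?thesis
  proof cases
    case pos
    then show ?thesis using square_equivalence_word_eq[OF assms(1-3) pos(3)] by simp
  next
    case neg
    then have "(snd p, snd q) \<in> square_words \<Lambda> d"
      using assms(4) unfolding square_words_def by auto
    then show ?thesis using R relation_word_eq by blast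
  qed
qed

theorem theorem5p4:
  fixes \<Lambda> :: "('v, 'm) pre_category" and d :: "'m \<Rightarrow> nat ^ 'k"
    and v :: 'v and T :: "('v, 'm) pre_digraph"
  assumes "k_graph \<Lambda> d"
    and "connected_category \<Lambda>"
    and "v \<in> Obj \<Lambda>"
    and "maximal_spanning_tree T (skeleton \<Lambda> d)"
  shows "fundamental_group \<Lambda> d v \<cong>
         presented_group (arcs (skeleton \<Lambda> d)) (tree_relations T \<union> square_words \<Lambda> d)"
proof -
  let ?X = "arcs (skeleton \<Lambda> d)" and ?R = "tree_relations T \<union> square_words \<Lambda> d"
  interpret groupoid_relations "skeleton \<Lambda> d" T v "square_relations \<Lambda> d"
  proof
    show "maximal_spanning_tree T (skeleton \<Lambda> d)" by fact
    show "v \<in> verts (skeleton \<Lambda> d)" using assms(3) by (simp add: skeleton_def)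
  qed (rule relations_parallel[OF assms(1)], rule UnI2)
  have R: "presentation ?X ?R"
    by unfold_locales (rule presentation_words[OF assms(1,4)])
  have "(snd p, snd q) \<in> presentation_congruence ?X ?R" if "(p, q) \<in> square_relations \<Lambda> d" for p q
    by (rule square_relations_word_eq[OF assms(1) R Un_upper2 that])
  then have "map_prod snd snd ` square_relations \<Lambda> d \<subseteq> presentation_congruence ?X ?R"
    unfolding map_prod_def by (clarify elim!: imageE) blast
  moreover have "tree_relations T \<subseteq> presentation_congruence ?X ?R"
    using presentation.relation_word_eq[OF R] by (intro subrelI) blast
  ultimately have "relation_words \<subseteq> presentation_congruence ?X ?R"
    unfolding relation_words_def by (rule Un_least[rotated])
  \<comment> \<open>A two-letter relation is a pair of \<open>square_relations\<close> with its
    vertices forgotten.\<close>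
  moreover have "square_words \<Lambda> d \<subseteq> map_prod snd snd ` square_relations \<Lambda> d"
  proof (rule subrelI)
    fix a b assume "(a, b) \<in> square_words \<Lambda> d"
    then obtain u u' where "((u, a), (u', b)) \<in> square_relations \<Lambda> d"
      unfolding square_words_def by blast
    from imageI[OF this, of "map_prod snd snd"]
    show "(a, b) \<in> map_prod snd snd ` square_relations \<Lambda> d" by simp
  qed
  then have "?R \<subseteq> relation_words"
    unfolding relation_words_def by (rule Un_mono[OF subset_refl])
  then have "?R \<subseteq> presentation_congruence ?X relation_words"
    using relation_word_eq by (intro subrelI) blast
  \<comment> \<open>A presented group depends on its relations only through the congruence they
    generate.\<close>
  ultimately have "presented_group ?X relation_words = presented_group ?X ?R"
    using presentation_congruence_eqI[OF presentation_axioms R] by (simp add: presented_group_def)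
  then show ?thesis
    using isotropy_group_iso_presented_group
    by (simp add: fundamental_group_def fundamental_groupoid_def \<theta>_def)
qed

end
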